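(* Let $n\ge 1$. If a deterministic matching mechanism for $n$ agents and $n$ items is implemented by (agent-proposing) Deferred Acceptance with fixed preferences for the items, then it is serializable.
   Context: Agents $A=\{a_1,\dots,a_n\}$ and items $B=\{b_1,\dots,b_n\}$. An ordinal matching problem instance consists of $n$ preference lists, one per agent; each list is a permutation of $B$. Agent $a_i$ prefers $b_j$ over $b_k$ if $b_j$ appears before $b_k$ in the list of $a_i$. A deterministic matching mechanism is a function mapping each instance to a perfect matching, i.e. a bijection $A\to B$. Deferred Acceptance with fixed item preferences: for each item fix, once and for all (independently of the instance), a strict ranking of the agents. Given an instance, proceed in rounds. In each round, every agent without a current match proposes to their favorite item (according to their list) that they have not yet proposed to. Then each item compares its proposals together with its current match (if it has one), keeps its favorite according to its fixed ranking, and rejects the rest. This continues until all agents are matched; the resulting matching is the output. A deterministic mechanism is serializable if there exist permutations $\pi$ and $\sigma$ of $[n]$ with the following property: whenever the mechanism is given an instance where, for each $1\le i<j\le n$, $a_{\pi(i)}$ prefers $b_{\sigma(i)}$ over $b_{\sigma(j)}$, it matches $a_{\pi(i)}$ to $b_{\sigma(i)}$ for all $i\in[n]$. *)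

theory Defs
  imports
    "HOL-Combinatorics.Combinatorics"
    "HOL-Library.FuncSet"
    "HOL-Library.While_Combinator"
begin

text \<open>
  Agent $a_i$ and item $b_i$ are both represented by their index \<open>i \<in> {1..n}\<close>.  A preference list is a
  duplicate-free list enumerating \<open>{1..n}\<close>, most preferred element first.
\<close>

type_synonym agent = nat
type_synonym item = nat
type_synonym prefs = "agent \<Rightarrow> item list"
type_synonym ranking = "item \<Rightarrow> agent list"
type_synonym matching = "agent \<Rightarrow> item"
type_synonym mechanism = "prefs \<Rightarrow> matching"

definition instances :: "nat \<Rightarrow> prefs set" where
  "instances n = {1..n} \<rightarrow>\<^sub>E permutations_of_set {1..n}"

definition rankings :: "nat \<Rightarrow> ranking set" where
  "rankings n = {1..n} \<rightarrow>\<^sub>E permutations_of_set {1..n}"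

definition prefers :: "'a list \<Rightarrow> 'a \<Rightarrow> 'a \<Rightarrow> bool" where
  "prefers xs x y \<longleftrightarrow> (\<exists>i j. i < j \<and> j < length xs \<and> xs ! i = x \<and> xs ! j = y)"

definition matching_mechanism :: "nat \<Rightarrow> mechanism \<Rightarrow> bool" where
  "matching_mechanism n M \<longleftrightarrow> (\<forall>P \<in> instances n. bij_betw (M P) {1..n} {1..n})"

record da_state =
  held :: "item \<Rightarrow> agent option"
  proposed :: "agent \<Rightarrow> item set"

definition da_init :: da_state where
  "da_init = \<lparr>held = (\<lambda>_. None), proposed = (\<lambda>_. {})\<rparr>"

definition matched :: "nat \<Rightarrow> da_state \<Rightarrow> agent \<Rightarrow> bool" where
  "matched n s a \<longleftrightarrow> (\<exists>b \<in> {1..n}. held s b = Some a)"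

definition proposal :: "nat \<Rightarrow> prefs \<Rightarrow> da_state \<Rightarrow> agent \<Rightarrow> item option" where
  "proposal n P s a =
     (if a \<in> {1..n} \<and> \<not> matched n s a then find (\<lambda>b. b \<notin> proposed s a) (P a) else None)"

text \<open>
  \<^const>\<open>find\<close> returns the first list entry satisfying the predicate, hence the favourite one.  An item that
  has neither a current match nor a proposal therefore stays at \<^const>\<open>None\<close>.
\<close>

definition da_round :: "nat \<Rightarrow> ranking \<Rightarrow> prefs \<Rightarrow> da_state \<Rightarrow> da_state" where
  "da_round n R P s =
     \<lparr>held = (\<lambda>b. find (\<lambda>a. proposal n P s a = Some b \<or> held s b = Some a) (R b)),
      proposed = (\<lambda>a. proposed s a \<union> set_option (proposal n P s a))\<rparr>"

text \<open>
  \<^const>\<open>while\<close> is unspecified on loops that do not terminate, so termination of Deferred Acceptance is not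
  built into this definition.
\<close>

definition da_final :: "nat \<Rightarrow> ranking \<Rightarrow> prefs \<Rightarrow> da_state" where
  "da_final n R P = while (\<lambda>s. \<not> (\<forall>a \<in> {1..n}. matched n s a)) (da_round n R P) da_init"

definition deferred_acceptance :: "nat \<Rightarrow> ranking \<Rightarrow> mechanism" where
  "deferred_acceptance n R P a = (THE b. b \<in> {1..n} \<and> held (da_final n R P) b = Some a)"

definition implemented_by_DA :: "nat \<Rightarrow> mechanism \<Rightarrow> bool" where
  "implemented_by_DA n M \<longleftrightarrow>
     (\<exists>R \<in> rankings n. \<forall>P \<in> instances n. \<forall>a \<in> {1..n}. M P a = deferred_acceptance n R P a)"

definition serializable :: "nat \<Rightarrow> mechanism \<Rightarrow> bool" where
  "serializable n M \<longleftrightarrow>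
     (\<exists>\<pi> \<sigma>. \<pi> permutes {1..n} \<and> \<sigma> permutes {1..n} \<and>
        (\<forall>P \<in> instances n.
           (\<forall>i j. 1 \<le> i \<and> i < j \<and> j \<le> n \<longrightarrow> prefers (P (\<pi> i)) (\<sigma> i) (\<sigma> j)) \<longrightarrow>
           (\<forall>i \<in> {1..n}. M P (\<pi> i) = \<sigma> i)))"

end

theory Submission
  imports Defs
begin

text \<open>
  Let every item in turn, in the order $1, \dots, n$, pick its favourite agent among those not yet
  picked; \<open>\<pi> i\<close> is the agent picked by item \<open>i\<close>.  On an instance in which each \<open>\<pi> i\<close> prefers \<open>i\<close> to all
  later items, item \<open>i\<close> never rejects \<open>\<pi> i\<close>: a better candidate would be \<open>\<pi> k\<close> for some \<open>k < i\<close>, but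
  \<open>\<pi> k\<close> proposes to \<open>k\<close> before \<open>i\<close> and is then kept by \<open>k\<close>.  So no agent exhausts its list, Deferred
  Acceptance terminates, and in the end \<open>\<pi> i\<close> holds no item after \<open>i\<close>, hence by induction on \<open>i\<close>
  exactly \<open>i\<close>.
\<close>

text \<open>Distinctness matters from left to right: a second copy of \<open>x\<close> further down
  would make entries after the first hit count as preferred to \<open>x\<close>.\<close>

lemma find_eq_Some_prefers:
  assumes "distinct xs"
  shows "find Q xs = Some x \<longleftrightarrow> x \<in> set xs \<and> Q x \<and> (\<forall>y. prefers xs y x \<longrightarrow> \<not> Q y)"
proof
  assume "find Q xs = Some x"
  then obtain i where i: "i < length xs" "Q (xs ! i)" "x = xs ! i" "\<forall>j<i. \<not> Q (xs ! j)"
    by (auto simp: find_Some_iff)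
  then show "x \<in> set xs \<and> Q x \<and> (\<forall>y. prefers xs y x \<longrightarrow> \<not> Q y)"
    using assms by (auto simp: prefers_def nth_eq_iff_index_eq)
next
  assume r: "x \<in> set xs \<and> Q x \<and> (\<forall>y. prefers xs y x \<longrightarrow> \<not> Q y)"
  then obtain i where i: "i < length xs" "xs ! i = x"
    by (auto simp: in_set_conv_nth)
  then have "\<forall>j<i. \<not> Q (xs ! j)"
    using r by (auto simp: prefers_def)
  then show "find Q xs = Some x"
    using i r by (auto simp: find_Some_iff)
qed

section \<open>Serial picking by the items\<close>

fun pick :: "ranking \<Rightarrow> item \<Rightarrow> agent" where
  \<comment> \<open>The recursion is well-founded because the bounded quantifier admits only calls
    with \<open>j < i\<close>.\<close>
  "pick R i = the (find (\<lambda>a. \<forall>j\<in>{1..<i}. pick R j \<noteq> a) (R i))"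

declare pick.simps [simp del]

lemma rankings_nth:
  assumes "R \<in> rankings n" "i \<in> {1..n}"
  shows "set (R i) = {1..n}" "distinct (R i)"
  using assms by (auto simp: rankings_def permutations_of_set_def PiE_def Pi_def)

lemma instances_nth:
  assumes "P \<in> instances n" "a \<in> {1..n}"
  shows "set (P a) = {1..n}" "distinct (P a)"
  using assms by (auto simp: instances_def permutations_of_set_def PiE_def Pi_def)

text \<open>Pigeonhole: fewer than \<open>n\<close> agents are gone when item \<open>i\<close> picks
  and \<open>R i\<close> lists all \<open>n\<close>, so \<open>the\<close> in \<open>pick\<close>
  never meets \<open>None\<close> here.\<close>

lemma find_pick:
  assumes R: "R \<in> rankings n" and i: "i \<in> {1..n}"
  shows "find (\<lambda>a. \<forall>j\<in>{1..<i}. pick R j \<noteq> a) (R i) = Some (pick R i)"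
proof -
  have "card (pick R ` {1..<i}) \<le> card {1..<i}"
    by (rule card_image_le) simp
  also have "\<dots> < card {1..n}"
    using i by auto
  finally have "\<not> {1..n} \<subseteq> pick R ` {1..<i}"
    by (meson card_mono finite_atLeastLessThan finite_imageI not_le)
  then have "find (\<lambda>a. \<forall>j\<in>{1..<i}. pick R j \<noteq> a) (R i) \<noteq> None"
    using rankings_nth[OF R i] by (auto simp: find_None_iff)
  then show ?thesis
    by (auto simp: pick.simps[of R i])
qed

lemma pick_in_range:
  assumes "R \<in> rankings n" "i \<in> {1..n}"
  shows "pick R i \<in> {1..n}"
  using find_pick[OF assms] rankings_nth[OF assms] by (simp add: find_eq_Some_prefers)

lemma inj_on_pick:
  assumes R: "R \<in> rankings n"
  shows "inj_on (pick R) {1..n}"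
proof (rule linorder_inj_onI')
  fix i j assume "i \<in> {1..n}" "j \<in> {1..n}" "i < j"
  then show "pick R i \<noteq> pick R j"
    using find_pick[OF R, of j] rankings_nth[OF R, of j] by (auto simp: find_eq_Some_prefers)
qed

lemma pick_surj:
  assumes R: "R \<in> rankings n"
  shows "pick R ` {1..n} = {1..n}"
proof (rule endo_inj_surj)
  show "pick R ` {1..n} \<subseteq> {1..n}"
    using pick_in_range[OF R] by blast
qed (use inj_on_pick[OF R] in simp_all)

text \<open>The search through \<open>R i\<close> passes over an agent only if an earlier item has
  picked it.\<close>

lemma prefers_pick:
  assumes "R \<in> rankings n" "i \<in> {1..n}" "prefers (R i) a (pick R i)"
  shows "\<exists>k\<in>{1..<i}. a = pick R k"
  using find_pick[OF assms(1,2)] rankings_nth[OF assms(1,2)] assms(3)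
  by (auto simp: find_eq_Some_prefers)

section \<open>Invariant of Deferred Acceptance on one instance\<close>

locale pick_compatible =
  fixes n :: nat and R :: ranking and P :: prefs
  assumes R: "R \<in> rankings n" and P: "P \<in> instances n"
    \<comment> \<open>The premise of serializability with \<pi> given by \<open>pick R\<close> and
      \<sigma> the identity.\<close>
    and compat: "\<lbrakk>1 \<le> i; i < j; j \<le> n\<rbrakk> \<Longrightarrow> prefers (P (pick R i)) i j"
begin

text \<open>The last clause is the goal: item \<open>i\<close> never lets go of
  \<open>pick R i\<close>. The fourth records that each agent works down its list, so its proposals
  form an initial segment.\<close>

definition da_inv :: "da_state \<Rightarrow> bool" where
  "da_inv s \<longleftrightarrow>
     (\<forall>a b. held s b = Some a \<longrightarrow> b \<in> {1..n} \<and> b \<in> proposed s a) \<and>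
     (\<forall>a b b'. held s b = Some a \<and> held s b' = Some a \<longrightarrow> b = b') \<and>
     (\<forall>a. proposed s a \<subseteq> {1..n}) \<and>
     (\<forall>a\<in>{1..n}. \<forall>b b'. b \<in> proposed s a \<and> prefers (P a) b' b \<longrightarrow> b' \<in> proposed s a) \<and>
     (\<forall>i\<in>{1..n}. i \<in> proposed s (pick R i) \<longrightarrow> held s i = Some (pick R i))"

lemma da_invD:
  assumes "da_inv s"
  shows da_inv_held: "held s b = Some a \<Longrightarrow> b \<in> {1..n} \<and> b \<in> proposed s a"
    and da_inv_unique: "\<lbrakk>held s b = Some a; held s b' = Some a\<rbrakk> \<Longrightarrow> b = b'"
    and da_inv_range: "proposed s a \<subseteq> {1..n}"
    and da_inv_prefix:
      "\<lbrakk>a \<in> {1..n}; b \<in> proposed s a; prefers (P a) b' b\<rbrakk> \<Longrightarrow> b' \<in> proposed s a"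
    and da_inv_pick:
      "\<lbrakk>i \<in> {1..n}; i \<in> proposed s (pick R i)\<rbrakk> \<Longrightarrow> held s i = Some (pick R i)"
  using assms unfolding da_inv_def by blast+

lemma da_inv_init: "da_inv da_init"
  by (simp add: da_inv_def da_init_def)

lemma proposal_SomeD:
  assumes "proposal n P s a = Some b"
  shows "a \<in> {1..n}" "b \<in> {1..n}" "\<not> matched n s a" "b \<notin> proposed s a"
    "prefers (P a) b' b \<Longrightarrow> b' \<in> proposed s a"
proof -
  have a: "a \<in> {1..n}" and m: "\<not> matched n s a"
    and f: "find (\<lambda>b. b \<notin> proposed s a) (P a) = Some b"
    using assms by (auto simp: proposal_def split: if_splits)
  from f show "a \<in> {1..n}" "b \<in> {1..n}" "\<not> matched n s a" "b \<notin> proposed s a"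
    "prefers (P a) b' b \<Longrightarrow> b' \<in> proposed s a"
    using a m instances_nth[OF P a] by (auto simp: find_eq_Some_prefers)
qed

definition candidate :: "da_state \<Rightarrow> agent \<Rightarrow> item \<Rightarrow> bool" where
  "candidate s a b \<longleftrightarrow> proposal n P s a = Some b \<or> held s b = Some a"

lemma held_da_round:
  "held (da_round n R P s) b = find (\<lambda>a. candidate s a b) (R b)"
  by (simp add: da_round_def candidate_def)

lemma proposed_da_round:
  "proposed (da_round n R P s) a = proposed s a \<union> set_option (proposal n P s a)"
  by (simp add: da_round_def)

lemma candidate_range:
  assumes "da_inv s" "candidate s a b"
  shows "b \<in> {1..n}"
  using assms da_inv_held proposal_SomeD(2) unfolding candidate_def by blast

lemma candidate_proposed:
  assumes "da_inv s" "candidate s a b"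
  shows "b \<in> proposed (da_round n R P s) a"
  using assms da_inv_held unfolding candidate_def proposed_da_round by auto

text \<open>Only unmatched agents propose, so no agent is both proposing and held.\<close>

lemma candidate_unique:
  assumes inv: "da_inv s" and "candidate s a b" "candidate s a b'"
  shows "b = b'"
proof -
  have False if "proposal n P s a = Some c" "held s c' = Some a" for c c'
    using proposal_SomeD(3)[OF that(1)] that(2) da_inv_held[OF inv] by (auto simp: matched_def)
  then show ?thesis
    using assms da_inv_unique[OF inv] unfolding candidate_def by fastforce
qed

lemma held_da_roundD:
  assumes "held (da_round n R P s) b = Some a"
  shows "candidate s a b"
  using assms by (auto simp: held_da_round find_Some_iff)

text \<open>Such an agent would be a candidate for two items at once.\<close>

lemma candidate_not_prefers_pick:
  assumes inv: "da_inv s" and i: "i \<in> {1..n}"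
    and pref: "prefers (R i) a (pick R i)"
  shows "\<not> candidate s a i"
proof
  assume cand: "candidate s a i"
  obtain k where k: "k \<in> {1..<i}" and a: "a = pick R k"
    using prefers_pick[OF R i pref] by blast
  have kn: "k \<in> {1..n}" and p: "prefers (P a) k i"
    using k i compat a by auto
  have "a \<in> {1..n}"
    using a pick_in_range[OF R kn] by simp
  \<comment> \<open>Whether \<open>a\<close> proposes to \<open>i\<close> now or is held by it, the
    better item \<open>k\<close> is among its past proposals.\<close>
  then have "k \<in> proposed s a"
    using cand p proposal_SomeD(5) da_inv_held[OF inv] da_inv_prefix[OF inv]
    unfolding candidate_def by blast
  then have "candidate s a k"
    using da_inv_pick[OF inv kn] a by (simp add: candidate_def)
  then show False
    using candidate_unique[OF inv cand] k by auto
qed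

lemma da_inv_round:
  assumes inv: "da_inv s"
  shows "da_inv (da_round n R P s)"
  unfolding da_inv_def
proof (intro conjI allI ballI impI)
  let ?s = "da_round n R P s"
  show "b \<in> {1..n}" "b \<in> proposed ?s a" if "held ?s b = Some a" for a b
    using held_da_roundD[OF that] candidate_range candidate_proposed inv by blast+
  show "b = b'" if "held ?s b = Some a \<and> held ?s b' = Some a" for a b b'
    using that held_da_roundD candidate_unique[OF inv] by blast
  show "proposed ?s a \<subseteq> {1..n}" for a
  proof -
    have "set_option (proposal n P s a) \<subseteq> {1..n}"
      using proposal_SomeD(2)[of s a] by (cases "proposal n P s a") auto
    then show ?thesis
      using da_inv_range[OF inv, of a] by (simp add: proposed_da_round)
  qed
  show "b' \<in> proposed ?s a"
    if "a \<in> {1..n}" "b \<in> proposed ?s a \<and> prefers (P a) b' b" for a b b'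
  proof -
    have "b \<in> proposed s a \<or> proposal n P s a = Some b"
      using that(2) by (auto simp: proposed_da_round elem_set)
    \<comment> \<open>A new proposal goes to the first untried item, so all better ones are in the
      old set already.\<close>
    then have "b' \<in> proposed s a"
      using that da_inv_prefix[OF inv that(1)] proposal_SomeD(5) by blast
    then show ?thesis
      by (simp add: proposed_da_round)
  qed
  show "held ?s i = Some (pick R i)"
    if i: "i \<in> {1..n}" and ip: "i \<in> proposed ?s (pick R i)" for i
  proof -
    \<comment> \<open>A proposal made in an earlier round counts too: by the invariant,
      \<open>i\<close> still holds \<open>pick R i\<close>.\<close>
    have "candidate s (pick R i) i"
      using ip da_inv_pick[OF inv i] unfolding proposed_da_round candidate_def
      by (auto simp: elem_set)
    then show ?thesis
      using candidate_not_prefers_pick[OF inv i] rankings_nth[OF R i] pick_in_range[OF R i]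
      by (auto simp: held_da_round find_eq_Some_prefers)
  qed
qed

section \<open>Termination\<close>

lemma proposal_unmatched:
  assumes inv: "da_inv s" and a: "a \<in> {1..n}" and un: "\<not> matched n s a"
  shows "proposal n P s a \<noteq> None"
proof -
  obtain i where i: "i \<in> {1..n}" "a = pick R i"
    using a pick_surj[OF R] by blast
  \<comment> \<open>Had the agent tried \<open>i\<close>, it would still be held there; so
    \<open>i\<close> remains on its list.\<close>
  then have "i \<notin> proposed s a"
    using da_inv_pick[OF inv] un unfolding matched_def by blast
  then show ?thesis
    using i a un instances_nth[OF P a] by (auto simp: proposal_def find_None_iff)
qed

text \<open>The termination measure of the loop.\<close>

definition remaining :: "da_state \<Rightarrow> nat" where
  "remaining s = (\<Sum>a\<in>{1..n}. card ({1..n} - proposed s a))"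

lemma remaining_da_round_less:
  assumes inv: "da_inv s" and un: "\<not> (\<forall>a\<in>{1..n}. matched n s a)"
  shows "remaining (da_round n R P s) < remaining s"
proof -
  obtain a b where a: "a \<in> {1..n}" and b: "proposal n P s a = Some b"
    using un proposal_unmatched[OF inv] by blast
  show ?thesis
    unfolding remaining_def
  proof (rule sum_strict_mono_ex1)
    show "finite {1..n}" by simp
    show "\<forall>a\<in>{1..n}. card ({1..n} - proposed (da_round n R P s) a) \<le> card ({1..n} - proposed s a)"
    proof
      fix a
      show "card ({1..n} - proposed (da_round n R P s) a) \<le> card ({1..n} - proposed s a)"
        by (rule card_mono) (simp, unfold proposed_da_round, blast)
    qed
    have "card ({1..n} - proposed (da_round n R P s) a) < card ({1..n} - proposed s a)"
    proof (rule psubset_card_mono)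
      show "{1..n} - proposed (da_round n R P s) a \<subset> {1..n} - proposed s a"
        using proposal_SomeD(2,4)[OF b] unfolding proposed_da_round b option.set by blast
    qed simp
    then show "\<exists>a\<in>{1..n}. card ({1..n} - proposed (da_round n R P s) a)
        < card ({1..n} - proposed s a)"
      using a by blast
  qed
qed

text \<open>The decrease of \<open>remaining\<close> makes the loop terminate, so
  \<open>while\<close> returns a state in which the loop condition fails.\<close>

lemma da_final_inv:
  "da_inv (da_final n R P) \<and> (\<forall>a\<in>{1..n}. matched n (da_final n R P) a)"
  unfolding da_final_def
  by (rule while_rule[where P = da_inv and r = "measure remaining"])
    (use da_inv_init da_inv_round remaining_da_round_less in auto)

section \<open>The final matching\<close>

lemma held_da_final:
  assumes "i \<in> {1..n}"
  shows "held (da_final n R P) i = Some (pick R i)"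
  using assms
proof (induction i rule: less_induct)
  case (less i)
  let ?s = "da_final n R P"
  have inv: "da_inv ?s"
    using da_final_inv by blast
  have a: "pick R i \<in> {1..n}"
    using pick_in_range[OF R less.prems] .
  then obtain b where b: "b \<in> {1..n}" "held ?s b = Some (pick R i)"
    using da_final_inv unfolding matched_def by blast
  consider "b < i" | "b = i" | "i < b" by linarith
  then show ?case
  proof cases
    case 1
    \<comment> \<open>This case is impossible: item \<open>b\<close> holds its own pick, and
      distinct items pick distinct agents.\<close>
    then have "pick R b = pick R i"
      using less.IH b by simp
    then show ?thesis
      using inj_on_eq_iff[OF inj_on_pick[OF R] b(1) less.prems] b(2) by simp
  next
    case 2
    then show ?thesis using b by simp
  next
    case 3
    \<comment> \<open>Proposals descend the list, so an agent held by \<open>b\<close> has tried the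
      better item \<open>i\<close>, which by the invariant has kept it.\<close>
    then have "i \<in> proposed ?s (pick R i)"
      using da_inv_prefix[OF inv a] da_inv_held[OF inv b(2)] compat[of i b] less.prems by auto
    then show ?thesis
      using da_inv_pick[OF inv less.prems] by blast
  qed
qed

lemma deferred_acceptance_pick:
  assumes "i \<in> {1..n}"
  shows "deferred_acceptance n R P (pick R i) = i"
  unfolding deferred_acceptance_def
proof (rule the_equality)
  show "i \<in> {1..n} \<and> held (da_final n R P) i = Some (pick R i)"
    using assms held_da_final by blast
  show "b = i" if "b \<in> {1..n} \<and> held (da_final n R P) b = Some (pick R i)" for b
    using that held_da_final[OF assms] da_final_inv da_inv_unique by blast
qed

end

theorem mainTheorem4:
  fixes n :: nat and M :: mechanism
  assumes "n \<ge> 1"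
    and "matching_mechanism n M"
    and "implemented_by_DA n M"
  shows "serializable n M"
proof -
  obtain R where R: "R \<in> rankings n"
    and M: "\<And>P a. \<lbrakk>P \<in> instances n; a \<in> {1..n}\<rbrakk> \<Longrightarrow> M P a = deferred_acceptance n R P a"
    using assms(3) unfolding implemented_by_DA_def by blast
  \<comment> \<open>\<open>permutes\<close> demands the identity outside \<open>{1..n}\<close>. The
    choice depends on \<open>R\<close> alone, so it is fixed before any instance.\<close>
  define \<pi> where "\<pi> = (\<lambda>i. if i \<in> {1..n} then pick R i else i)"
  have \<pi>_pick: "\<pi> i = pick R i" if "i \<in> {1..n}" for i
    using that unfolding \<pi>_def by (rule if_P)
  have "bij_betw (pick R) {1..n} {1..n}"
    using inj_on_pick[OF R] pick_surj[OF R] by (simp add: bij_betw_def)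
  then have "bij_betw \<pi> {1..n} {1..n}"
    using bij_betw_cong[of "{1..n}" \<pi> "pick R"] \<pi>_pick by blast
  then have "\<pi> permutes {1..n}"
    by (rule bij_imp_permutes) (unfold \<pi>_def, rule if_not_P)
  moreover have "M P (\<pi> i) = i"
    if P: "P \<in> instances n" and i: "i \<in> {1..n}"
      and pref: "\<forall>i j. 1 \<le> i \<and> i < j \<and> j \<le> n \<longrightarrow> prefers (P (\<pi> i)) i j" for P i
  proof -
    interpret pick_compatible n R P
    proof
      show "prefers (P (pick R i)) i j" if "1 \<le> i" "i < j" "j \<le> n" for i j
      proof -
        have "prefers (P (\<pi> i)) i j"
          using pref that by blast
        then show ?thesis
          using that \<pi>_pick[of i] by simp
      qed
    qed (use R P in auto)
    show ?thesis
      using deferred_acceptance_pick[OF i] M[OF P pick_in_range[OF R i]] \<pi>_pick[OF i] by simp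
  qed
  ultimately show ?thesis
    unfolding serializable_def
    by (intro exI[of _ \<pi>] exI[of _ id]) (auto simp: permutes_id)
qed

end
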